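(* There exists an ordering of the edges of the Pascal diagram into $0,1$ such that the set $X_{\min}$ of infinite minimal paths has the cardinality of the continuum and the set $X_{\max}$ of infinite maximal paths is countably infinite.
   Context: The Pascal diagram is the infinite graded graph with vertex set $\mathbb Z_+\times\mathbb Z_+$ (where $\mathbb Z_+=\{0,1,2,\dots\}$), levels $V_n=\{(i,j): i+j=n\}$, and, from each vertex $(i,j)$, exactly one edge to $(i+1,j)$ and exactly one edge to $(i,j+1)$; edges are directed from level $V_n$ to level $V_{n+1}$. Infinite paths are sequences of connected edges $(e_0,e_1,\dots)$ starting at $(0,0)$ with $e_n$ joining $V_n$ to $V_{n+1}$. An ordering of the edges (into $0,1$) is a choice, for every vertex $v\neq(0,0)$, of a linear order on the set $r^{-1}(v)$ of edges arriving at $v$: if $v=(i,j)$ with $i,j\ge 1$, one of its two incoming edges is labeled $0$ (minimal) and the other is labeled $1$ (maximal); if $v$ has a single incoming edge ($i=0$ or $j=0$), that edge is both minimal and maximal. An infinite path is minimal (respectively maximal) if each of its edges $e$ is minimal (respectively maximal) in $r^{-1}(r(e))$, where $r(e)$ is the endpoint of $e$ on the higher-indexed level. *)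

theory Defs
  imports Complex_Main "HOL-Library.Countable_Set" "HOL-Library.Equipollence"
begin

type_synonym vertex = "nat \<times> nat"

(* There is at most one edge between two vertices, so an edge is the pair
   (source, range) of its endpoints. *)
type_synonym edge = "vertex \<times> vertex"

definition level :: "nat \<Rightarrow> vertex set" where
  "level n = {(i, j). i + j = n}"

definition pascal_edges :: "edge set" where
  "pascal_edges = {((i, j), (Suc i, j)) | i j. True} \<union> {((i, j), (i, Suc j)) | i j. True}"

abbreviation edge_source :: "edge \<Rightarrow> vertex" where
  "edge_source \<equiv> fst"

abbreviation edge_range :: "edge \<Rightarrow> vertex" where
  "edge_range \<equiv> snd"

definition incoming :: "vertex \<Rightarrow> edge set" where
  "incoming v = {e \<in> pascal_edges. edge_range e = v}"

definition infinite_paths :: "(nat \<Rightarrow> edge) set" where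
  "infinite_paths = {p. edge_source (p 0) = (0, 0) \<and>
     (\<forall>n. p n \<in> pascal_edges \<and>
          edge_source (p n) \<in> level n \<and> edge_range (p n) \<in> level (Suc n) \<and>
          edge_range (p n) = edge_source (p (Suc n)))}"

(* R v is a reflexive order: (e, f) \<in> R v reads e \<le> f. Incoming sets have at most two
   elements, so the labels 0 and 1 of the edges arriving at an interior vertex are
   their ranks in this order. *)
definition edge_ordering :: "(vertex \<Rightarrow> edge rel) \<Rightarrow> bool" where
  "edge_ordering R \<longleftrightarrow> (\<forall>v. v \<noteq> (0, 0) \<longrightarrow> linear_order_on (incoming v) (R v))"

definition minimal_edge :: "(vertex \<Rightarrow> edge rel) \<Rightarrow> edge \<Rightarrow> bool" where
  "minimal_edge R e \<longleftrightarrow>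
     e \<in> pascal_edges \<and> (\<forall>f \<in> incoming (edge_range e). (e, f) \<in> R (edge_range e))"

definition maximal_edge :: "(vertex \<Rightarrow> edge rel) \<Rightarrow> edge \<Rightarrow> bool" where
  "maximal_edge R e \<longleftrightarrow>
     e \<in> pascal_edges \<and> (\<forall>f \<in> incoming (edge_range e). (f, e) \<in> R (edge_range e))"

definition X_min :: "(vertex \<Rightarrow> edge rel) \<Rightarrow> (nat \<Rightarrow> edge) set" where
  "X_min R = {p \<in> infinite_paths. \<forall>n. minimal_edge R (p n)}"

definition X_max :: "(vertex \<Rightarrow> edge rel) \<Rightarrow> (nat \<Rightarrow> edge) set" where
  "X_max R = {p \<in> infinite_paths. \<forall>n. maximal_edge R (p n)}"

lemma incoming_interior:
  "incoming (Suc i, Suc j) = {((i, Suc j), (Suc i, Suc j)), ((Suc i, j), (Suc i, Suc j))}"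
  by (auto simp: incoming_def pascal_edges_def)

lemma incoming_left: "incoming (0, Suc j) = {((0, j), (0, Suc j))}"
  by (auto simp: incoming_def pascal_edges_def)

lemma incoming_right: "incoming (Suc i, 0) = {((i, 0), (Suc i, 0))}"
  by (auto simp: incoming_def pascal_edges_def)

end

theory Submission
  imports Defs "HOL-Analysis.Abstract_Topology_2"
begin

text \<open>
  Write the vertex \<open>(k, n - k)\<close> as position \<open>k\<close> of level \<open>n\<close>. An infinite path is then a walk on
  the naturals that at each step keeps its position or raises it by one, and an ordering says, for
  every interior vertex, which of the two possible steps into it is the minimal one; the other is
  the maximal one.

  Suppose that, among the minimal steps from level \<open>n\<close> to level \<open>n + 1\<close>, those into positions
  \<open>k \<le> m\<close> keep the position and those into positions \<open>k > m\<close> raise it, for some \<open>m\<close> depending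
  on \<open>n\<close>. In the tree of minimal edges position \<open>m\<close> then gets two children and every other
  position gets one: the level, seen as a linearly ordered set of leaves, has its \<open>m\<close>-th leaf
  split in two. This is how the set of gaps between finitely many reals grows when one more real is
  added. Let \<open>q\<close> enumerate the rationals and split at odd levels \<open>2 * r + 1\<close> the gap that contains
  \<open>q r\<close>. Each real \<open>t\<close> then gives a minimal walk, namely the number of points \<open>q l \<le> t\<close> among
  those added so far (lemma \<open>cut_walk_follows\<close>), and distinct reals give distinct walks since the
  rationals are dense. There are at most continuum many walks at all.

  In the tree of maximal edges, on the other hand, a vertex off the two boundary lines never has
  two children off them. Hence only one maximal walk passes through a given interior vertex
  (lemma \<open>follows_complement_unique\<close>), and the maximal walks are countable in number. A maximal
  walk off the boundary ends if it meets a position that is just being split. That infinitely many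
  escape this is due to the even levels, at which the rightmost position is split and every maximal
  step into an interior vertex raises the position. Off the boundary the maximal walks thus move at
  slope at least one half, whereas the splitting at level \<open>2 * r + 1\<close> is at a position \<open>\<le> r\<close>, and
  the walks that leave the line \<open>k = n\<close> at odd levels stay to the right of all later splittings at
  odd levels (lemma \<open>drift_follows\<close>).
\<close>

section \<open>Paths as walks and orderings as step rules\<close>

definition walk :: "(nat \<Rightarrow> nat) \<Rightarrow> bool" where
  "walk x \<longleftrightarrow> x 0 = 0 \<and> (\<forall>n. x (Suc n) = x n \<or> x (Suc n) = Suc (x n))"

definition path_of_walk :: "(nat \<Rightarrow> nat) \<Rightarrow> nat \<Rightarrow> edge" where
  "path_of_walk x n = ((x n, n - x n), (x (Suc n), Suc n - x (Suc n)))"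

text \<open>A rule \<open>U\<close> selects one of the two steps into each interior vertex: \<open>U n k\<close> says that position
  \<open>k\<close> of level \<open>n + 1\<close> is entered from the same position of level \<open>n\<close>. The complementary rule
  selects the other step.\<close>

definition follows :: "(nat \<Rightarrow> nat \<Rightarrow> bool) \<Rightarrow> (nat \<Rightarrow> nat) \<Rightarrow> bool" where
  "follows U x \<longleftrightarrow> walk x \<and>
     (\<forall>n. 0 < x (Suc n) \<and> x (Suc n) \<le> n \<longrightarrow> (x (Suc n) = x n \<longleftrightarrow> U n (x (Suc n))))"

abbreviation complement_rule :: "(nat \<Rightarrow> nat \<Rightarrow> bool) \<Rightarrow> nat \<Rightarrow> nat \<Rightarrow> bool" where
  "complement_rule U \<equiv> \<lambda>n k. \<not> U n k"

text \<open>The two edges into an interior vertex are told apart by whether the first coordinate of the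
  source equals that of the range. On the boundary the order consists of the pair given by
  \<open>e = f\<close>, whatever the rule says there.\<close>

definition rule_order :: "(nat \<Rightarrow> nat \<Rightarrow> bool) \<Rightarrow> vertex \<Rightarrow> edge rel" where
  "rule_order U v = {(e, f). e \<in> incoming v \<and> f \<in> incoming v \<and>
     (e = f \<or> (fst (fst e) = fst v \<longleftrightarrow> U (fst v + snd v - 1) (fst v)))}"

lemma walk_step: "walk x \<Longrightarrow> x (Suc n) = x n \<or> x (Suc n) = Suc (x n)"
  by (simp add: walk_def)

lemma walk_le: "walk x \<Longrightarrow> x n \<le> n"
proof (induction n)
  case 0
  then show ?case by (simp add: walk_def)
next
  case (Suc n)
  then show ?case using walk_step[of x n] by auto
qed

lemma infinite_paths_eq: "infinite_paths = path_of_walk ` {x. walk x}"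
proof (intro equalityI subsetI)
  fix p assume p: "p \<in> infinite_paths"
  define x where "x n = fst (fst (p n))" for n
  have source: "fst (p n) = (x n, n - x n)" for n
  proof -
    have "fst (p n) \<in> level n"
      using p by (simp add: infinite_paths_def)
    then show ?thesis
      by (auto simp: level_def x_def)
  qed
  have range: "snd (p n) = fst (p (Suc n))" and edge: "p n \<in> pascal_edges" for n
    using p by (auto simp: infinite_paths_def)
  have "p n = path_of_walk x n" for n
    using source range by (simp add: path_of_walk_def prod_eq_iff)
  moreover have "walk x"
    unfolding walk_def
  proof (intro conjI allI)
    show "x 0 = 0"
      using p by (simp add: infinite_paths_def x_def)
    have "fst (snd (p n)) = fst (fst (p n)) \<or> fst (snd (p n)) = Suc (fst (fst (p n)))" for n
      using edge[of n] by (auto simp: pascal_edges_def)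
    then show "x (Suc n) = x n \<or> x (Suc n) = Suc (x n)" for n
      by (simp add: x_def range)
  qed
  ultimately show "p \<in> path_of_walk ` {x. walk x}"
    by (auto intro!: image_eqI[of _ _ x])
next
  fix p assume "p \<in> path_of_walk ` {x. walk x}"
  then obtain x where p: "p = path_of_walk x" and x: "walk x"
    by auto
  have "path_of_walk x n \<in> pascal_edges" for n
    using walk_step[OF x, of n] walk_le[OF x, of n]
    by (auto simp: path_of_walk_def pascal_edges_def Suc_diff_le)
  moreover have "x 0 = 0"
    using x by (simp add: walk_def)
  ultimately show "p \<in> infinite_paths"
    using walk_le[OF x] walk_le[OF x, of "Suc _"]
    by (auto simp: p infinite_paths_def path_of_walk_def level_def)
qed

lemma inj_path_of_walk: "inj path_of_walk"
proof (rule injI)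
  fix x y assume "path_of_walk x = path_of_walk y"
  then have "path_of_walk x n = path_of_walk y n" for n
    by simp
  then show "x = y"
    by (auto simp: path_of_walk_def)
qed

lemma incoming_cases:
  assumes "e \<in> incoming (i, j)"
  shows "(j > 0 \<and> e = ((i, j - 1), (i, j))) \<or> (i > 0 \<and> e = ((i - 1, j), (i, j)))"
  using assms by (auto simp: incoming_def pascal_edges_def)

lemma edge_ordering_rule_order: "edge_ordering (rule_order U)"
  unfolding edge_ordering_def linear_order_on_def partial_order_on_def preorder_on_def
proof (intro allI impI conjI)
  fix v :: vertex
  have unique: "e = f"
    if "e \<in> incoming v" "f \<in> incoming v" "fst (fst e) = fst v \<longleftrightarrow> fst (fst f) = fst v" for e f
    using that incoming_cases[of e "fst v" "snd v"] incoming_cases[of f "fst v" "snd v"] by auto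
  show "rule_order U v \<subseteq> incoming v \<times> incoming v"
    by (auto simp: rule_order_def)
  show "refl_on (incoming v) (rule_order U v)"
    by (auto simp: refl_on_def rule_order_def)
  show "trans (rule_order U v)"
    by (auto simp: trans_def rule_order_def)
  show "antisym (rule_order U v)"
    using unique unfolding antisym_def rule_order_def by blast
  show "total_on (incoming v) (rule_order U v)"
    unfolding total_on_def
  proof (intro ballI impI)
    fix e f assume ef: "e \<in> incoming v" "f \<in> incoming v" "e \<noteq> f"
    then have "(fst (fst e) = fst v) \<noteq> (fst (fst f) = fst v)"
      using unique by blast
    then show "(e, f) \<in> rule_order U v \<or> (f, e) \<in> rule_order U v"
      using ef by (auto simp: rule_order_def)
  qed
qed

text \<open>On the boundary the single incoming edge is both minimal and maximal, which is why
  \<open>follows\<close> constrains only the steps into interior vertices.\<close>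

lemma extremal_edge_walk:
  assumes "walk x"
  shows minimal_edge_walk: "minimal_edge (rule_order U) (path_of_walk x n) \<longleftrightarrow>
      (0 < x (Suc n) \<and> x (Suc n) \<le> n \<longrightarrow> (x (Suc n) = x n \<longleftrightarrow> U n (x (Suc n))))"
    and maximal_edge_walk: "maximal_edge (rule_order U) (path_of_walk x n) \<longleftrightarrow>
      (0 < x (Suc n) \<and> x (Suc n) \<le> n \<longrightarrow> (x (Suc n) = x n \<longleftrightarrow> \<not> U n (x (Suc n))))"
proof -
  define i where "i = x (Suc n)"
  define j where "j = Suc n - x (Suc n)"
  define e where "e = path_of_walk x n"
  have sum: "i + j = Suc n" and le: "x n \<le> n"
    using walk_le[OF assms, of "Suc n"] walk_le[OF assms, of n] by (auto simp: i_def j_def)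
  have "path_of_walk x \<in> infinite_paths"
    using assms by (simp add: infinite_paths_eq)
  then have edge: "e \<in> pascal_edges"
    by (simp add: infinite_paths_def e_def)
  have e: "e = ((x n, n - x n), (i, j))"
    by (simp add: e_def path_of_walk_def i_def j_def)
  have inc: "e \<in> incoming (i, j)"
    using edge by (simp add: incoming_def e)
  have interior: "0 < x (Suc n) \<and> x (Suc n) \<le> n \<longleftrightarrow> i > 0 \<and> j > 0"
    using sum by (auto simp: i_def)
  have min_max: "((\<forall>f \<in> incoming (i, j). (e, f) \<in> rule_order U (i, j)) \<longleftrightarrow>
          (0 < i \<and> 0 < j \<longrightarrow> (i = x n \<longleftrightarrow> U n i))) \<and>
        ((\<forall>f \<in> incoming (i, j). (f, e) \<in> rule_order U (i, j)) \<longleftrightarrow>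
          (0 < i \<and> 0 < j \<longrightarrow> (i = x n \<longleftrightarrow> \<not> U n i)))"
  proof (cases "0 < i \<and> 0 < j")
    case True
    then obtain i' j' where ij: "i = Suc i'" "j = Suc j'"
      by (metis gr0_implies_Suc)
    have n: "Suc (i' + j') = n"
      using sum ij by simp
    consider "e = ((i', Suc j'), (Suc i', Suc j'))" | "e = ((Suc i', j'), (Suc i', Suc j'))"
      using inc by (auto simp: ij incoming_interior)
    then show ?thesis
    proof cases
      case 1
      then have "x n = i'"
        using e by simp
      then show ?thesis
        by (simp add: 1 ij n incoming_interior rule_order_def)
    next
      case 2
      then have "x n = Suc i'"
        using e by simp
      then show ?thesis
        by (simp add: 2 ij n incoming_interior rule_order_def)
    qed
  next
    case False
    then have "f = e" if "f \<in> incoming (i, j)" for f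
      using that inc incoming_cases[of e i j] incoming_cases[of f i j] by auto
    then show ?thesis
      using False inc by (auto simp: rule_order_def)
  qed
  have rng: "snd e = (i, j)"
    by (simp add: e)
  show "minimal_edge (rule_order U) (path_of_walk x n) \<longleftrightarrow>
      (0 < x (Suc n) \<and> x (Suc n) \<le> n \<longrightarrow> (x (Suc n) = x n \<longleftrightarrow> U n (x (Suc n))))"
    using min_max edge unfolding interior e_def[symmetric] minimal_edge_def rng
    by (simp add: i_def)
  show "maximal_edge (rule_order U) (path_of_walk x n) \<longleftrightarrow>
      (0 < x (Suc n) \<and> x (Suc n) \<le> n \<longrightarrow> (x (Suc n) = x n \<longleftrightarrow> \<not> U n (x (Suc n))))"
    using min_max edge unfolding interior e_def[symmetric] maximal_edge_def rng
    by (simp add: i_def)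
qed

lemma X_min_rule_order: "X_min (rule_order U) = path_of_walk ` {x. follows U x}"
proof -
  have "follows U x \<longleftrightarrow> walk x \<and> (\<forall>n. minimal_edge (rule_order U) (path_of_walk x n))" for x
    unfolding follows_def by (simp add: minimal_edge_walk cong: conj_cong)
  then show ?thesis
    unfolding X_min_def infinite_paths_eq by auto
qed

lemma X_max_rule_order: "X_max (rule_order U) = path_of_walk ` {x. follows (complement_rule U) x}"
proof -
  have "follows (complement_rule U) x \<longleftrightarrow> walk x \<and> (\<forall>n. maximal_edge (rule_order U) (path_of_walk x n))" for x
    unfolding follows_def by (simp add: maximal_edge_walk cong: conj_cong)
  then show ?thesis
    unfolding X_max_def infinite_paths_eq by auto
qed

section \<open>Cardinality bounds\<close>

lemma walks_lepoll_reals: "{x. walk x} \<lesssim> (UNIV :: real set)"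
proof -
  define rises where "rises x = {n. x (Suc n) \<noteq> x n}" for x :: "nat \<Rightarrow> nat"
  have "inj_on rises {x. walk x}"
  proof (rule inj_onI)
    fix x y assume "x \<in> {x. walk x}" "y \<in> {x. walk x}" and eq: "rises x = rises y"
    then have x: "walk x" and y: "walk y"
      by auto
    have "x n = y n" for n
    proof (induction n)
      case 0
      then show ?case using x y by (simp add: walk_def)
    next
      case (Suc n)
      have "x (Suc n) = x n \<longleftrightarrow> y (Suc n) = y n"
        using eq by (auto simp: rises_def)
      then show ?case
        using Suc walk_step[OF x, of n] walk_step[OF y, of n] by auto
    qed
    then show "x = y" ..
  qed
  then have "{x. walk x} \<lesssim> (UNIV :: nat set set)"
    by (auto simp: lepoll_def)
  then show ?thesis
    by (rule lepoll_trans2) (rule nat_sets_eqpoll_reals)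
qed

text \<open>The history of a walk that follows a rule can be read off from its present position, as the
  rule leaves one way into each vertex.\<close>

lemma follows_same_history:
  assumes x: "follows U x" and y: "follows U y" and "x m = y m" and "n \<le> m"
  shows "x n = y n"
  using \<open>n \<le> m\<close>
proof (induction rule: inc_induct)
  case base
  then show ?case by fact
next
  case (step n)
  have wx: "walk x" and wy: "walk y"
    using x y by (auto simp: follows_def)
  note steps = walk_step[OF wx, of n] walk_step[OF wy, of n] walk_le[OF wx, of n] walk_le[OF wy, of n]
  show ?case
  proof (cases "0 < x (Suc n) \<and> x (Suc n) \<le> n")
    case True
    then have "x (Suc n) = x n \<longleftrightarrow> y (Suc n) = y n"
      using x y step.IH unfolding follows_def by metis
    then show ?thesis
      using steps step.IH by auto
  next
    case False
    then show ?thesis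
      using steps step.IH by auto
  qed
qed

text \<open>If \<open>U n\<close> is downward closed, the complementary rule cannot send position \<open>k\<close> both to \<open>k\<close>
  and to \<open>k + 1\<close>: that would require \<open>U n (k + 1)\<close> without \<open>U n k\<close>. So the future of a walk is
  determined, too, once it has left the boundary; and it cannot return there.\<close>

lemma follows_complement_unique:
  assumes U: "\<And>n k. U n (Suc k) \<Longrightarrow> U n k"
    and x: "follows (complement_rule U) x" and y: "follows (complement_rule U) y"
    and eq: "x m = y m" and interior: "0 < x m" "x m < m"
  shows "x = y"
proof
  fix n
  have wx: "walk x" and wy: "walk y"
    using x y by (auto simp: follows_def)
  show "x n = y n"
  proof (cases "n \<le> m")
    case True
    then show ?thesis
      using follows_same_history[OF x y eq] by blast
  next
    case False
    then have "m \<le> n" by simp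
    then have "x n = y n \<and> 0 < x n \<and> x n < n"
    proof (induction rule: dec_induct)
      case base
      then show ?case using eq interior by simp
    next
      case (step n)
      have "x (Suc n) = x n \<longleftrightarrow> \<not> U n (x (Suc n))" "y (Suc n) = y n \<longleftrightarrow> \<not> U n (y (Suc n))"
        using x y step.IH walk_step[OF wx, of n] walk_step[OF wy, of n]
        unfolding follows_def by (metis Suc_leI less_imp_le zero_less_Suc)+
      then show ?case
        using step.IH U[of n "x n"] walk_step[OF wx, of n] walk_step[OF wy, of n] by auto
    qed
    then show ?thesis ..
  qed
qed

lemma boundary_walk:
  assumes x: "walk x" and boundary: "\<And>n. x n = 0 \<or> x n = n"
  shows "x = (\<lambda>_. 0) \<or> x = id"
proof -
  define b where "b \<longleftrightarrow> x 1 = 0"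
  have after: "x (Suc n) = (if b then 0 else Suc n)" for n
  proof (induction n)
    case 0
    then show ?case using boundary[of 1] by (auto simp: b_def)
  next
    case (Suc n)
    then show ?case
      using walk_step[OF x, of "Suc n"] boundary[of "Suc (Suc n)"] by (auto split: if_splits)
  qed
  have "x n = (if b then 0 else n)" for n
    using after boundary[of 0] by (cases n) auto
  then show ?thesis
    by (cases b) (auto simp: fun_eq_iff)
qed

lemma countable_follows_complement:
  assumes U: "\<And>n k. U n (Suc k) \<Longrightarrow> U n k"
  shows "countable {x. follows (complement_rule U) x}"
proof -
  define through where
    "through v = {x. follows (complement_rule U) x \<and> x (fst v) = snd v \<and> 0 < snd v \<and> snd v < fst v}"
    for v :: "nat \<times> nat"
  have "countable (through v)" for v
  proof (cases "through v = {}")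
    case False
    then obtain x where "x \<in> through v"
      by blast
    then have "through v \<subseteq> {x}"
      using follows_complement_unique[OF U, where x = x and m = "fst v"]
      by (force simp: through_def)
    then show ?thesis
      by (rule countable_subset) simp
  qed simp
  then have "countable ({\<lambda>_. 0, id} \<union> (\<Union>v. through v))"
    by simp
  moreover have "{x. follows (complement_rule U) x} \<subseteq> {\<lambda>_. 0, id} \<union> (\<Union>v. through v)"
  proof
    fix x assume "x \<in> {x. follows (complement_rule U) x}"
    then have fx: "follows (complement_rule U) x" and wx: "walk x"
      by (auto simp: follows_def)
    show "x \<in> {\<lambda>_. 0, id} \<union> (\<Union>v. through v)"
    proof (cases "\<forall>n. x n = 0 \<or> x n = n")
      case True
      then show ?thesis using boundary_walk[OF wx] by auto
    next
      case False
      then obtain n where "0 < x n" "x n < n"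
        using walk_le[OF wx] by (metis gr0I le_neq_implies_less)
      then have "x \<in> through (n, x n)"
        using fx by (simp add: through_def)
      then show ?thesis by blast
    qed
  qed
  ultimately show ?thesis
    by (rule countable_subset[rotated])
qed

section \<open>Splitting gaps at a sequence of reals\<close>

definition insert_rank :: "(nat \<Rightarrow> real) \<Rightarrow> nat \<Rightarrow> nat" where
  "insert_rank q r = card {l. l < r \<and> q l < q r}"

text \<open>At an even level the threshold \<open>insert_rank\<close> is replaced by infinity: the last position splits,
  and no walk that stands for a real number moves.\<close>

definition gap_rule :: "(nat \<Rightarrow> real) \<Rightarrow> nat \<Rightarrow> nat \<Rightarrow> bool" where
  "gap_rule q n k \<longleftrightarrow> even n \<or> k \<le> insert_rank q (n div 2)"

definition cut_walk :: "(nat \<Rightarrow> real) \<Rightarrow> real \<Rightarrow> nat \<Rightarrow> nat" where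
  "cut_walk q t n = card {l. l < n div 2 \<and> q l \<le> t}"

lemma gap_rule_downward: "gap_rule q n (Suc k) \<Longrightarrow> gap_rule q n k"
  by (auto simp: gap_rule_def)

lemma insert_rank_le: "insert_rank q r \<le> r"
  using card_mono[of "{..<r}" "{l. l < r \<and> q l < q r}"] by (auto simp: insert_rank_def)

lemma cut_walk_even_step: "even n \<Longrightarrow> cut_walk q t (Suc n) = cut_walk q t n"
  by (simp add: cut_walk_def)

lemma cut_walk_odd_step:
  assumes "odd n"
  shows "cut_walk q t (Suc n) = (if q (n div 2) \<le> t then Suc (cut_walk q t n) else cut_walk q t n)"
proof -
  have half: "Suc n div 2 = Suc (n div 2)"
    using assms by simp
  have "{l. l < Suc r \<and> q l \<le> t} = (if q r \<le> t
      then insert r {l. l < r \<and> q l \<le> t} else {l. l < r \<and> q l \<le> t})" for r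
    by (auto simp: less_Suc_eq)
  then show ?thesis
    unfolding cut_walk_def half by simp
qed

text \<open>When \<open>q r\<close> is added, a real \<open>t < q r\<close> has at most \<open>insert_rank q r\<close> of the earlier points
  below or at it, so that it may keep its position; a real \<open>t \<ge> q r\<close> has at least that many, so that
  its raised position exceeds the threshold.\<close>

lemma cut_walk_follows: "follows (gap_rule q) (cut_walk q t)"
  unfolding follows_def walk_def
proof (intro conjI allI impI)
  show "cut_walk q t 0 = 0"
    by (simp add: cut_walk_def)
  show "cut_walk q t (Suc n) = cut_walk q t n \<or> cut_walk q t (Suc n) = Suc (cut_walk q t n)" for n
    using cut_walk_even_step cut_walk_odd_step by (cases "even n") auto
  show "cut_walk q t (Suc n) = cut_walk q t n \<longleftrightarrow> gap_rule q n (cut_walk q t (Suc n))" for n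
  proof (cases "even n")
    case True
    then show ?thesis by (simp add: cut_walk_even_step gap_rule_def)
  next
    case False
    have below: "cut_walk q t n \<le> insert_rank q (n div 2)" if "t < q (n div 2)"
      unfolding cut_walk_def insert_rank_def using that by (intro card_mono) auto
    have above: "insert_rank q (n div 2) \<le> cut_walk q t n" if "q (n div 2) \<le> t"
      unfolding cut_walk_def insert_rank_def using that by (intro card_mono) auto
    show ?thesis
      using False below above by (auto simp: cut_walk_odd_step gap_rule_def)
  qed
qed

lemma inj_cut_walk:
  assumes dense: "\<And>s t. s < t \<Longrightarrow> \<exists>r. s < q r \<and> q r < t"
  shows "inj (cut_walk q)"
proof (rule linorder_injI)
  fix s t :: real assume "s < t"
  then obtain r where r: "s < q r" "q r < t"
    using dense by blast
  let ?n = "Suc (2 * r)"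
  have "cut_walk q s ?n \<le> cut_walk q t ?n"
    unfolding cut_walk_def using \<open>s < t\<close> by (intro card_mono) auto
  then have "cut_walk q s (Suc ?n) < cut_walk q t (Suc ?n)"
    using r by (simp add: cut_walk_odd_step)
  then show "cut_walk q s \<noteq> cut_walk q t"
    by auto
qed

section \<open>Maximal walks that survive\<close>

text \<open>The walk runs along the line \<open>k = n\<close> up to level \<open>2 * c + 1\<close> and from there on keeps its
  position at the steps from odd levels only. At level \<open>2 * r + 1\<close> with \<open>r \<ge> c\<close> its position is
  \<open>r + 1 + c\<close>, to the right of the splitting, whose position is at most \<open>r\<close>.\<close>

definition drift :: "nat \<Rightarrow> nat \<Rightarrow> nat" where
  "drift c n = n - (n div 2 - c)"

lemma drift_even_step: "even n \<Longrightarrow> drift c (Suc n) = Suc (drift c n)"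
  by (simp add: drift_def Suc_diff_le)

lemma drift_odd_step:
  assumes "odd n"
  shows "drift c (Suc n) = (if c \<le> n div 2 then drift c n else Suc (drift c n))"
proof -
  obtain r where "n = 2 * r + 1"
    using assms by (elim oddE)
  then show ?thesis
    by (auto simp: drift_def)
qed

lemma drift_follows: "follows (complement_rule (gap_rule q)) (drift c)"
  unfolding follows_def walk_def
proof (intro conjI allI impI)
  show "drift c 0 = 0"
    by (simp add: drift_def)
  show "drift c (Suc n) = drift c n \<or> drift c (Suc n) = Suc (drift c n)" for n
    using drift_even_step drift_odd_step by (cases "even n") auto
  show "drift c (Suc n) = drift c n \<longleftrightarrow> \<not> gap_rule q n (drift c (Suc n))"
    if "0 < drift c (Suc n) \<and> drift c (Suc n) \<le> n" for n
  proof (cases "even n")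
    case True
    then show ?thesis
      by (simp add: drift_even_step gap_rule_def)
  next
    case False
    then obtain r where n: "n = 2 * r + 1"
      by (elim oddE)
    have "c \<le> r"
      using that by (auto simp: n drift_def)
    then have "drift c (Suc n) = drift c n" "drift c n > r"
      by (auto simp: n drift_def)
    then show ?thesis
      using False insert_rank_le[of q r] by (simp add: gap_rule_def n)
  qed
qed

lemma inj_drift: "inj drift"
proof (rule linorder_injI)
  fix c d :: nat assume "c < d"
  then have "drift c (2 * d) < drift d (2 * d)"
    by (simp add: drift_def)
  then show "drift c \<noteq> drift d"
    by auto
qed

section \<open>The ordering\<close>

theorem theorem4p2:
  shows "\<exists>R. edge_ordering R \<and>
    X_min R \<approx> (UNIV :: real set) \<and>
    countable (X_max R) \<and> infinite (X_max R)"
proof -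
  define q where "q = from_nat_into (\<rat> :: real set)"
  define R where "R = rule_order (gap_rule q)"
  have "range q = \<rat>"
    unfolding q_def by (rule range_from_nat_into) (use Rats_0 countable_rat in auto)
  then have dense: "\<exists>r. s < q r \<and> q r < t" if "s < t" for s t
    using Rats_dense_in_real[OF that] by (metis imageE)
  have "X_min R \<lesssim> {x. follows (gap_rule q) x}"
    unfolding R_def X_min_rule_order by (rule image_lepoll)
  also have "\<dots> \<lesssim> {x. walk x}"
    by (rule subset_imp_lepoll) (auto simp: follows_def)
  also have "\<dots> \<lesssim> (UNIV :: real set)"
    by (rule walks_lepoll_reals)
  finally have upper: "X_min R \<lesssim> (UNIV :: real set)" .
  have "inj (path_of_walk \<circ> cut_walk q)"
    by (intro inj_compose inj_path_of_walk inj_cut_walk dense)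
  moreover have "range (path_of_walk \<circ> cut_walk q) \<subseteq> X_min R"
    using cut_walk_follows by (auto simp: R_def X_min_rule_order)
  ultimately have lower: "(UNIV :: real set) \<lesssim> X_min R"
    unfolding lepoll_def by blast
  have "countable (X_max R)"
    unfolding R_def X_max_rule_order
    using countable_follows_complement[OF gap_rule_downward] by (rule countable_image)
  moreover have "infinite (X_max R)"
  proof
    assume "finite (X_max R)"
    moreover have "range (path_of_walk \<circ> drift) \<subseteq> X_max R"
      using drift_follows by (auto simp: R_def X_max_rule_order)
    ultimately have "finite (range (path_of_walk \<circ> drift))"
      by (rule finite_subset[rotated])
    then show False
      using finite_imageD[OF _ inj_compose[OF inj_path_of_walk inj_drift]] by simp
  qed
  ultimately show ?thesis
    using edge_ordering_rule_order[of "gap_rule q"] lepoll_antisym[OF upper lower]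
    unfolding R_def by blast
qed

end
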